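(* There is an absolute constant $C>0$ such that the following holds. Let $D$ be a dataset of $n$ $d$-dimensional tuples ($d\ge2$), let $\mathcal{S}$ be a nonempty collection of nonempty subsets of $D$, let $\mathcal{K}\subseteq\{1,\dots,n\}$, let $\varepsilon>0$, let $\gamma\ge1$ be an integer, and let the sample size be $m=\left\lceil C\,\frac{\ln|\mathcal{S}|+\ln n}{\varepsilon^2}\right\rceil$. Let $\mathbb{D}=\mathbb{D}_a\cup\mathbb{D}_b$ be the random discrete vector set built with parameters $m$ and $\gamma$. Then with probability at least $1-\frac1n$ (over $\mathbb{D}_a$), for all $S\in\mathcal{S}$ and all $k\in\mathcal{K}$: if $\nabla_{\mathbb{D}}(S)\le k$, then $\mathrm{Rat}_k(S)\ge 1-\varepsilon$.
   Context: A dataset $D$ is a set of $n$ distinct tuples in $[0,1]^d$ such that for each attribute $i$ some $t\in D$ has $t[i]=1$. The utility of $t$ for a nonnegative vector $u\in\mathbb{R}^d$ is $w(u,t)=\sum_i u[i]t[i]$; $w_k(u,D)$ is the $k$-th highest utility (with multiplicity) of tuples of $D$ for $u$. The rank $\nabla_u(t)$ is one plus the number of $t'\in D$ with $w(u,t')>w(u,t)$; $\nabla_u(S)=\min_{t\in S}\nabla_u(t)$ and $\nabla_{\mathbb{V}}(S)=\max_{u\in\mathbb{V}}\nabla_u(S)$ for a set $\mathbb{V}$ of vectors. $\mathbb{S}=\{u\in\mathbb{R}^d: u[i]\ge0\ \forall i,\ \|u\|_2=1\}$. $V_{\mathbb{S},k}(t)=\{u\in\mathbb{S}: w(u,t)\ge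 w_k(u,D)\}$, and $\mathrm{Rat}_k(S)=\mathrm{Area}\big(\bigcup_{t\in S}V_{\mathbb{S},k}(t)\big)/\mathrm{Area}(\mathbb{S})$, where $\mathrm{Area}$ is $(d-1)$-dimensional surface area. $\mathbb{D}_a$ is a set of $m$ independent samples from the uniform distribution on $\mathbb{S}$. $\mathbb{D}_b\subseteq\mathbb{S}$ is the image of the grid $\{(\frac{z_1\pi}{2\gamma},\dots,\frac{z_{d-1}\pi}{2\gamma}): z_i\in\{0,1,\dots,\gamma\}\}$ under the polar map $(\theta[1],\dots,\theta[d-1])\mapsto u$, $u[i]=\sin(\theta[d-1])\sin(\theta[d-2])\cdots\sin(\theta[i])\cos(\theta[i-1])$ for $1\le i\le d$, with $\theta[0]=0$. *)

theory Defs
  imports "HOL-Probability.Probability" "HOL-Library.Multiset"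
begin

text \<open>
  The dimension \<open>d\<close> has to be quantified inside the statement (the constant does not depend on it),
  so points of \<open>\<real>\<^sup>d\<close> are functions in \<^term>\<open>{1..d} \<rightarrow>\<^sub>E (UNIV :: real set)\<close>, and Lebesgue measure on
  \<open>\<real>\<^sup>d\<close> is the product measure \<open>Pi\<^sub>M {1..d} (\<lambda>_. lborel)\<close>.
\<close>

type_synonym point = "nat \<Rightarrow> real"

definition dataset :: "nat \<Rightarrow> point set \<Rightarrow> bool" where
  "dataset d D \<longleftrightarrow> finite D \<and> D \<subseteq> ({1..d} \<rightarrow>\<^sub>E {0..1}) \<and> (\<forall>i\<in>{1..d}. \<exists>t\<in>D. t i = 1)"

definition utility :: "nat \<Rightarrow> point \<Rightarrow> point \<Rightarrow> real" where
  "utility d u t = (\<Sum>i=1..d. u i * t i)"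

text \<open>Utilities are sorted as a multiset, so ties count with multiplicity; meaningful for
  \<open>1 \<le> k \<le> card D\<close>.\<close>

definition kth_utility :: "nat \<Rightarrow> point set \<Rightarrow> nat \<Rightarrow> point \<Rightarrow> real" where
  "kth_utility d D k u =
     rev (sorted_list_of_multiset (image_mset (utility d u) (mset_set D))) ! (k - 1)"

definition tuple_rank :: "nat \<Rightarrow> point set \<Rightarrow> point \<Rightarrow> point \<Rightarrow> nat" where
  "tuple_rank d D u t = 1 + card {t' \<in> D. utility d u t' > utility d u t}"

definition rank_set :: "nat \<Rightarrow> point set \<Rightarrow> point \<Rightarrow> point set \<Rightarrow> nat" where
  "rank_set d D u S = Min (tuple_rank d D u ` S)"

definition max_rank :: "nat \<Rightarrow> point set \<Rightarrow> point set \<Rightarrow> point set \<Rightarrow> nat" where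
  "max_rank d D V S = Max ((\<lambda>u. rank_set d D u S) ` V)"

definition pos_sphere :: "nat \<Rightarrow> point set" where
  "pos_sphere d = {u \<in> {1..d} \<rightarrow>\<^sub>E UNIV. (\<forall>i\<in>{1..d}. u i \<ge> 0) \<and> L2_set u {1..d} = 1}"

text \<open>
  Surface measure on the unit sphere of \<open>\<real>\<^sup>d\<close>, normalised as usual: the \<open>(d-1)\<close>-dimensional area
  of \<open>A\<close> is \<open>d\<close> times the volume of the cone \<open>{r u | 0 < r \<le> 1, u \<in> A}\<close>, i.e. of the set of
  points \<open>x\<close> of the punctured unit ball with \<open>x / \<parallel>x\<parallel> \<in> A\<close>
  (see \<open>emeasure_surface_measure\<close> below). This is the measure \<open>\<sigma>\<close> for which
  \<open>dx = r\<^sup>d\<^sup>-\<^sup>1 dr d\<sigma>\<close> in polar coordinates.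
\<close>

definition surface_measure :: "nat \<Rightarrow> point measure" where
  "surface_measure d = scale_measure (of_nat d)
     (distr (restrict_space (\<Pi>\<^sub>M i\<in>{1..d}. lborel) {x. 0 < L2_set x {1..d} \<and> L2_set x {1..d} \<le> 1})
            (\<Pi>\<^sub>M i\<in>{1..d}. borel)
            (\<lambda>x. \<lambda>i\<in>{1..d}. x i / L2_set x {1..d}))"

definition area :: "nat \<Rightarrow> point set \<Rightarrow> real" where
  "area d A = measure (surface_measure d) A"

definition top_region :: "nat \<Rightarrow> point set \<Rightarrow> nat \<Rightarrow> point \<Rightarrow> point set" where
  "top_region d D k t = {u \<in> pos_sphere d. utility d u t \<ge> kth_utility d D k u}"

definition area_ratio :: "nat \<Rightarrow> point set \<Rightarrow> nat \<Rightarrow> point set \<Rightarrow> real" where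
  "area_ratio d D k S = area d (\<Union>t\<in>S. top_region d D k t) / area d (pos_sphere d)"

definition uniform_sphere :: "nat \<Rightarrow> point measure" where
  "uniform_sphere d = uniform_measure (surface_measure d) (pos_sphere d)"

lemma L2_set_measurable[measurable]:
  "(\<lambda>x. L2_set x {1..d}) \<in> borel_measurable (\<Pi>\<^sub>M i\<in>{1..d::nat}. (borel::real measure))"
  unfolding L2_set_def by measurable

lemma sets_PiM_lborel: "sets (\<Pi>\<^sub>M i\<in>{1..d::nat}. (lborel::real measure)) = sets (\<Pi>\<^sub>M i\<in>{1..d}. borel)"
  by (intro sets_PiM_cong) auto

lemma space_PiM_lborel: "space (\<Pi>\<^sub>M i\<in>{1..d::nat}. (lborel::real measure)) = {1..d} \<rightarrow>\<^sub>E UNIV"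
  by (simp add: space_PiM)

lemma pos_sphere_sets[measurable]: "pos_sphere d \<in> sets (\<Pi>\<^sub>M i\<in>{1..d}. borel)"
proof -
  have "pos_sphere d = {u \<in> space (\<Pi>\<^sub>M i\<in>{1..d}. borel). (\<forall>i\<in>{1..d}. u i \<ge> 0) \<and> L2_set u {1..d} = 1}"
    by (simp add: pos_sphere_def space_PiM)
  also have "\<dots> \<in> sets (\<Pi>\<^sub>M i\<in>{1..d}. borel)" by measurable
  finally show ?thesis .
qed

lemma L2_set_scale: "r \<ge> 0 \<Longrightarrow> L2_set (\<lambda>i\<in>A. r * u i) A = r * L2_set u A"
  by (simp add: L2_set_right_distrib cong: L2_set_cong)

lemma emeasure_surface_measure:
  assumes A: "A \<in> sets (\<Pi>\<^sub>M i\<in>{1..d}. borel)" "\<And>u. u \<in> A \<Longrightarrow> L2_set u {1..d} = 1"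
  shows "emeasure (surface_measure d) A =
           of_nat d * emeasure (\<Pi>\<^sub>M i\<in>{1..d}. lborel)
                        {\<lambda>i\<in>{1..d}. r * u i | r u. 0 < r \<and> r \<le> 1 \<and> u \<in> A}" 
proof -
  let ?P = "\<Pi>\<^sub>M i\<in>{1..d}. (lborel::real measure)" 
  let ?B = "{x. 0 < L2_set x {1..d} \<and> L2_set x {1..d} \<le> 1}"
  let ?f = "\<lambda>x. \<lambda>i\<in>{1..d}. x i / L2_set x {1..d}"
  have [measurable]: "(\<lambda>x. L2_set x {1..d}) \<in> borel_measurable ?P"
    using L2_set_measurable measurable_cong_sets[OF sets_PiM_lborel refl] by blast
  have f0: "?f \<in> measurable ?P (\<Pi>\<^sub>M i\<in>{1..d}. borel)" by measurable
  have f: "?f \<in> measurable (restrict_space ?P ?B) (\<Pi>\<^sub>M i\<in>{1..d}. borel)"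
    by (rule measurable_restrict_space1[OF f0])
  have B: "?B \<inter> space ?P \<in> sets ?P"
    by measurable
  have Asub: "A \<subseteq> {1..d} \<rightarrow>\<^sub>E UNIV" using sets.sets_into_space[OF A(1)] by (simp add: space_PiM)
  have eq: "?f -` A \<inter> space (restrict_space ?P ?B) = {\<lambda>i\<in>{1..d}. r * u i | r u. 0 < r \<and> r \<le> 1 \<and> u \<in> A}"
    (is "?l = ?r")
  proof (intro set_eqI iffI)
    fix x assume x: "x \<in> ?l"
    then have "x = (\<lambda>i\<in>{1..d}. L2_set x {1..d} * ?f x i)"
      by (auto simp: space_restrict_space space_PiM PiE_def extensional_def fun_eq_iff)
    moreover have "0 < L2_set x {1..d}" "L2_set x {1..d} \<le> 1" "?f x \<in> A"
      using x by (auto simp: space_restrict_space)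
    ultimately show "x \<in> ?r" by blast
  next
    fix x assume "x \<in> ?r"
    then obtain r u where ru: "x = (\<lambda>i\<in>{1..d}. r * u i)" "0 < r" "r \<le> 1" "u \<in> A" by auto
    have n: "L2_set x {1..d} = r" using ru A(2)[of u] by (simp only: L2_set_scale less_imp_le mult_1_right)
    have "?f x = u" unfolding n using ru Asub
      by (auto simp: fun_eq_iff PiE_def extensional_def)
    with ru n show "x \<in> ?l" by (auto simp: space_restrict_space space_PiM)
  qed
  show ?thesis
    unfolding surface_measure_def emeasure_scale_measure emeasure_distr[OF f A(1)] eq[symmetric]
    by (subst emeasure_restrict_space) (use B in \<open>auto simp: space_restrict_space\<close>)
qed

lemma space_surface[simp]: "space (surface_measure d) = {1..d} \<rightarrow>\<^sub>E UNIV"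
  by (simp add: surface_measure_def space_scale_measure space_PiM)
lemma sets_surface[simp]: "sets (surface_measure d) = sets (\<Pi>\<^sub>M i\<in>{1..d}. borel)"
  by (simp add: surface_measure_def)

text \<open>In particular the area of \<^term>\<open>pos_sphere d\<close> is finite and positive, so normalising by it is meaningful.\<close>

lemma prob_space_uniform_sphere:
  assumes "d \<ge> 1" shows "prob_space (uniform_sphere d)"
proof -
  let ?P = "\<Pi>\<^sub>M i\<in>{1..d}. (lborel::real measure)" 
  let ?c = "{\<lambda>i\<in>{1..d}. r * u i | r u. 0 < r \<and> r \<le> 1 \<and> u \<in> pos_sphere d}"
  interpret product_sigma_finite "\<lambda>_::nat. lborel::real measure" ..
  have e: "emeasure (surface_measure d) (pos_sphere d) = of_nat d * emeasure ?P ?c"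
    by (rule emeasure_surface_measure[OF pos_sphere_sets]) (auto simp: pos_sphere_def)
  have box: "emeasure ?P ({1..d} \<rightarrow>\<^sub>E {a..b}) = ennreal ((b - a) ^ d)" if "a \<le> b" for a b :: real
    using that by (subst emeasure_PiM) (auto simp: ennreal_power)
  have [measurable]: "(\<lambda>x. L2_set x {1..d}) \<in> borel_measurable ?P"
    using L2_set_measurable measurable_cong_sets[OF sets_PiM_lborel refl] by blast
  have c: "?c = {x\<in>space ?P. (\<forall>i\<in>{1..d}. x i \<ge> 0) \<and> 0 < L2_set x {1..d} \<and> L2_set x {1..d} \<le> 1}" (is "_ = ?r")
  proof (intro set_eqI iffI)
    fix x assume "x \<in> ?c"
    then obtain r u where ru: "x = (\<lambda>i\<in>{1..d}. r * u i)" "0 < r" "r \<le> 1" "u \<in> pos_sphere d" by auto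
    then have "L2_set x {1..d} = r" by (simp only: L2_set_scale less_imp_le) (simp add: pos_sphere_def)
    with ru show "x \<in> ?r" by (auto simp: space_PiM pos_sphere_def)
  next
    fix x assume x: "x \<in> ?r"
    let ?l = "L2_set x {1..d}" let ?u = "\<lambda>i\<in>{1..d}. (1/?l) * x i"
    have "L2_set ?u {1..d} = 1" using x by (subst L2_set_scale) auto
    then have "?u \<in> pos_sphere d" using x by (auto simp: pos_sphere_def)
    moreover have "x = (\<lambda>i\<in>{1..d}. ?l * ?u i)" using x
      by (auto simp: space_PiM PiE_def extensional_def fun_eq_iff)
    ultimately show "x \<in> ?c" using x by blast
  qed
  have cm: "?c \<in> sets ?P" unfolding c by measurable
  have up: "?c \<subseteq> {1..d} \<rightarrow>\<^sub>E {0..1}"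
  proof
    fix x assume x: "x \<in> ?c"
    have "x i \<le> 1" if "i \<in> {1..d}" for i
      using member_le_L2_set[of "{1..d}" i x] x that unfolding c by auto
    then show "x \<in> {1..d} \<rightarrow>\<^sub>E {0..1}" using x unfolding c by (auto simp: space_PiM PiE_def)
  qed
  have lo: "{1..d} \<rightarrow>\<^sub>E {1/(2*d)..1/d} \<subseteq> ?c"
  proof
    fix x assume x: "x \<in> {1..d} \<rightarrow>\<^sub>E {1/(2*d)..1/d}"
    have x1: "0 < x i" "x i \<le> 1/d" if "i \<in> {1..d}" for i
      using PiE_mem[OF x that] assms by (auto intro: less_le_trans[of 0 "1/(2*d)"])
    have "L2_set x {1..d} \<le> (\<Sum>i\<in>{1..d}. x i)" by (rule L2_set_le_sum) (use x1 in \<open>force\<close>)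
    also have "\<dots> \<le> (\<Sum>i\<in>{1..d}. 1/d)" by (rule sum_mono) (use x1 in auto)
    also have "\<dots> = 1" using assms by simp
    finally have "L2_set x {1..d} \<le> 1" .
    moreover have "0 < L2_set x {1..d}" 
      using member_le_L2_set[of "{1..d}" 1 x] x1[of 1] assms by auto
    ultimately show "x \<in> ?c" using x x1 unfolding c by (auto simp: space_PiM PiE_def less_imp_le)
  qed
  have "emeasure ?P ?c \<le> emeasure ?P ({1..d} \<rightarrow>\<^sub>E {0..1})"
    by (rule emeasure_mono[OF up]) (auto intro!: sets_PiM_I_finite)
  also have "\<dots> < \<infinity>" by (subst box) auto
  finally have fin: "emeasure ?P ?c < \<infinity>" .
  have "0 < ennreal ((1/d - 1/(2*d)) ^ d)" using assms by (simp add: field_simps)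
  also have "\<dots> = emeasure ?P ({1..d} \<rightarrow>\<^sub>E {1/(2*d)..1/d})" using assms by (subst box) (auto simp: field_simps)
  also have "\<dots> \<le> emeasure ?P ?c" by (rule emeasure_mono[OF lo cm])
  finally have pos: "0 < emeasure ?P ?c" .
  show ?thesis unfolding uniform_sphere_def
    by (rule prob_space_uniform_measure) (use fin pos assms e in \<open>auto simp: ennreal_mult_eq_top_iff\<close>)
qed

definition samples :: "nat \<Rightarrow> nat \<Rightarrow> (nat \<Rightarrow> point) measure" where
  "samples d m = (\<Pi>\<^sub>M j\<in>{..<m}. uniform_sphere d)"

definition polar :: "nat \<Rightarrow> (nat \<Rightarrow> real) \<Rightarrow> point" where
  "polar d \<theta> = (\<lambda>i\<in>{1..d}. (\<Prod>j=i..d-1. sin (\<theta> j)) * cos ((\<theta>(0 := 0)) (i - 1)))"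

definition grid_vectors :: "nat \<Rightarrow> nat \<Rightarrow> point set" where
  "grid_vectors d \<gamma> =
     (\<lambda>z. polar d (\<lambda>j. real (z j) * pi / (2 * real \<gamma>))) ` ({1..d-1} \<rightarrow>\<^sub>E {0..\<gamma>})"

end

theory Submission
  imports Defs
begin

text \<open>
  For fixed \<open>S\<close> and \<open>k\<close>, a sample \<open>u\<close> satisfies \<open>rank_set d D u S \<le> k\<close> iff it lies in the union of
  the top-\<open>k\<close> regions of the tuples of \<open>S\<close>. If that union covers a fraction \<open>p < 1 - \<epsilon>\<close> of the sphere,
  all \<open>m\<close> independent samples lie in it with probability \<open>p ^ m \<le> exp (- \<epsilon> * m)\<close>, which is at most
  \<open>1 / (card \<S> * n\<^sup>2)\<close> for \<open>C = 2\<close>. A union bound over the at most \<open>card \<S> * n\<close> pairs finishes the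
  argument; the grid vectors only strengthen the hypothesis.
\<close>

text \<open>In a descending list the entries above \<open>x\<close> form an initial segment, so the
  entry at index \<open>k - 1\<close> is among them exactly when at least \<open>k\<close> entries
  are. The bounds on \<open>k\<close> keep that index inside the list.\<close>

lemma rev_sorted_nth_le_iff:
  fixes x :: "'a::linorder"
  assumes "1 \<le> k" "k \<le> size M"
  shows "rev (sorted_list_of_multiset M) ! (k - 1) \<le> x \<longleftrightarrow> size {#y \<in># M. x < y#} < k"
proof -
  define ys where "ys = rev (sorted_list_of_multiset M)"
  have len: "length ys = size M"
    by (metis length_rev mset_sorted_list_of_multiset size_mset ys_def)
  have anti: "ys ! j \<le> ys ! i" if "i \<le> j" "j < length ys" for i j
    using that unfolding ys_def
    by (auto simp: rev_nth intro!: sorted_nth_mono)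
  \<comment> \<open>Counting positions instead of values keeps ties with their multiplicity.\<close>
  have "size {#y \<in># M. x < y#} = size (mset (filter (\<lambda>y. x < y) ys))"
    by (simp add: ys_def)
  also have "\<dots> = card {i. i < length ys \<and> x < ys ! i}"
    by (simp only: size_mset length_filter_conv_card)
  finally have size_eq: "size {#y \<in># M. x < y#} = card {i. i < length ys \<and> x < ys ! i}" .
  show ?thesis
  proof (cases "ys ! (k - 1) \<le> x")
    case True
    have "i < k - 1" if "i < length ys" "x < ys ! i" for i
      using anti[of "k - 1" i] that True by (meson leD le_less_trans not_le order_trans)
    then have "card {i. i < length ys \<and> x < ys ! i} \<le> card {..<k - 1}"
      by (intro card_mono) auto
    with True assms show ?thesis unfolding size_eq ys_def[symmetric] by simp
  next
    case False
    have "x < ys ! i" if "i < k" for i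
      using anti[of i "k - 1"] that False assms len by force
    then have "card {..<k} \<le> card {i. i < length ys \<and> x < ys ! i}"
      using assms len by (intro card_mono) auto
    with False show ?thesis unfolding size_eq ys_def[symmetric] by simp
  qed
qed

text \<open>Links the threshold in \<open>top_region\<close> to the counting in
  \<open>tuple_rank\<close>; the \<open>1 +\<close> in the rank turns a count below \<open>k\<close>
  into a rank at most \<open>k\<close>.\<close>

lemma kth_utility_le_iff_tuple_rank:
  assumes "finite D" "1 \<le> k" "k \<le> card D"
  shows "kth_utility d D k u \<le> utility d u t \<longleftrightarrow> tuple_rank d D u t \<le> k"
proof -
  have "kth_utility d D k u \<le> utility d u t \<longleftrightarrow>
      size {#y \<in># image_mset (utility d u) (mset_set D). utility d u t < y#} < k"
    unfolding kth_utility_def using assms by (intro rev_sorted_nth_le_iff) auto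
  also have "size {#y \<in># image_mset (utility d u) (mset_set D). utility d u t < y#} =
      card {t' \<in> D. utility d u t < utility d u t'}"
    using assms(1) by (simp add: filter_mset_image_mset)
  finally show ?thesis unfolding tuple_rank_def by linarith
qed

lemma rank_set_le_iff:
  assumes "finite S" "S \<noteq> {}"
  shows "rank_set d D u S \<le> k \<longleftrightarrow> (\<exists>t\<in>S. tuple_rank d D u t \<le> k)"
  unfolding rank_set_def using assms by (subst Min_le_iff) auto

lemma max_rank_le_iff:
  assumes "finite V" "V \<noteq> {}"
  shows "max_rank d D V S \<le> k \<longleftrightarrow> (\<forall>u\<in>V. rank_set d D u S \<le> k)"
  unfolding max_rank_def using assms by (subst Max_le_iff) auto

lemma utility_measurable[measurable]:
  "(\<lambda>u. utility d u t) \<in> borel_measurable (\<Pi>\<^sub>M i\<in>{1..d}. (borel :: real measure))"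
  unfolding utility_def by measurable

lemma tuple_rank_measurable:
  assumes "finite D"
  shows "(\<lambda>u. tuple_rank d D u t) \<in> measurable (\<Pi>\<^sub>M i\<in>{1..d}. (borel :: real measure)) (count_space UNIV)"
proof -
  \<comment> \<open>As a finite sum of indicators of comparisons between measurable functions, the
    cardinality is visibly measurable in \<open>u\<close>.\<close>
  have sum_eq: "tuple_rank d D u t =
      1 + (\<Sum>t'\<in>D. if utility d u t < utility d u t' then 1 else 0)" for u
    unfolding tuple_rank_def card_eq_sum sum.inter_filter[OF assms] ..
  show ?thesis unfolding sum_eq by measurable
qed

text \<open>Not restricted to \<open>pos_sphere d\<close>: with the whole space as ambient set, the
  event that all samples satisfy the rank bound is exactly a box in the product space, without
  discarding a null set.\<close>

definition rank_region :: "nat \<Rightarrow> point set \<Rightarrow> nat \<Rightarrow> point set \<Rightarrow> point set" where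
  "rank_region d D k S = {u \<in> {1..d} \<rightarrow>\<^sub>E UNIV. rank_set d D u S \<le> k}"

lemma sets_uniform_sphere: "sets (uniform_sphere d) = sets (\<Pi>\<^sub>M i\<in>{1..d}. borel)"
  by (simp add: uniform_sphere_def)

lemma space_uniform_sphere: "space (uniform_sphere d) = {1..d} \<rightarrow>\<^sub>E UNIV"
  by (simp add: uniform_sphere_def)

lemma rank_region_sets:
  assumes "finite D" "finite S" "S \<noteq> {}"
  shows "rank_region d D k S \<in> sets (\<Pi>\<^sub>M i\<in>{1..d}. borel)"
proof -
  note [measurable] = tuple_rank_measurable[OF assms(1)]
  have "rank_region d D k S =
      {u \<in> space (\<Pi>\<^sub>M i\<in>{1..d}. (borel :: real measure)). \<exists>t\<in>S. tuple_rank d D u t \<le> k}"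
    unfolding rank_region_def rank_set_le_iff[OF assms(2,3)] by (simp add: space_PiM)
  also have "\<dots> \<in> sets (\<Pi>\<^sub>M i\<in>{1..d}. borel)"
    using assms(2) by measurable
  finally show ?thesis .
qed

text \<open>\<open>uniform_sphere\<close> normalises the area on \<open>pos_sphere d\<close>, and
  inside that set the region is the union of the top regions.\<close>

lemma measure_rank_region:
  assumes "d \<ge> 1" "finite D" "S \<noteq> {}" "S \<subseteq> D" "1 \<le> k" "k \<le> card D"
  shows "measure (uniform_sphere d) (rank_region d D k S) = area_ratio d D k S"
proof -
  interpret prob_space "uniform_sphere d" by (rule prob_space_uniform_sphere[OF assms(1)])
  let ?e = "emeasure (surface_measure d) (pos_sphere d)"
  have S: "finite S" using assms by (auto intro: finite_subset)
  have R: "rank_region d D k S \<in> sets (surface_measure d)"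
    using rank_region_sets[OF assms(2) S assms(3)] by simp
  have "pos_sphere d \<inter> space (surface_measure d) = pos_sphere d"
    by (auto simp: pos_sphere_def)
  \<comment> \<open>Total mass 1 gives this quotient in \<open>ennreal\<close>, where both 0 / 0 and
    \<infinity> / \<infinity> are 0; hence the area is positive and finite.\<close>
  then have "?e / ?e = 1"
    using emeasure_space_1 sets.top[of "surface_measure d"] pos_sphere_sets[of d]
    by (simp add: uniform_sphere_def Int_commute del: space_surface)
  then have "?e \<noteq> 0" "?e < \<infinity>"
    by (auto simp: top.not_eq_extremum[symmetric])
  moreover have "pos_sphere d \<inter> rank_region d D k S = (\<Union>t\<in>S. top_region d D k t)"
    unfolding rank_region_def top_region_def rank_set_le_iff[OF S assms(3)]
      kth_utility_le_iff_tuple_rank[OF assms(2,5,6)]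
    by (auto simp: pos_sphere_def)
  ultimately show ?thesis
    unfolding uniform_sphere_def area_ratio_def area_def
    using R by (subst measure_uniform_measure) auto
qed

lemma prob_space_samples:
  assumes "d \<ge> 1" shows "prob_space (samples d m)"
  unfolding samples_def by (intro prob_space_PiM prob_space_uniform_sphere assms)

lemma measure_samples_all_in:
  assumes "d \<ge> 1" "A \<in> sets (uniform_sphere d)"
  shows "measure (samples d m) ({..<m} \<rightarrow>\<^sub>E A) = measure (uniform_sphere d) A ^ m"
proof -
  interpret prob_space "uniform_sphere d" by (rule prob_space_uniform_sphere[OF assms(1)])
  interpret finite_product_prob_space "\<lambda>_. uniform_sphere d" "{..<m}"
    by unfold_locales auto
  show ?thesis unfolding samples_def using assms(2) by (subst finite_measure_PiM_emb) auto
qed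

lemma finite_grid_vectors: "finite (grid_vectors d \<gamma>)"
  unfolding grid_vectors_def by (intro finite_imageI finite_PiE) auto

text \<open>Keeps the \<open>Max\<close> in \<open>max_rank\<close> over a nonempty set even when
  \<open>m = 0\<close>, which happens for \<open>card \<S> = 1\<close> and
  \<open>n = 1\<close>.\<close>

lemma grid_vectors_nonempty: "grid_vectors d \<gamma> \<noteq> {}"
  unfolding grid_vectors_def by (simp add: PiE_eq_empty_iff)

lemma power_le_inverse_of_sample_size:
  fixes p \<epsilon> s n :: real
  assumes "0 \<le> p" "p < 1 - \<epsilon>" "\<epsilon> > 0" "s \<ge> 1" "n \<ge> 1"
    and m: "real m \<ge> 2 * ((ln s + ln n) / \<epsilon>\<^sup>2)"
  shows "p ^ m \<le> 1 / (s * n\<^sup>2)"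
proof -
  have ln0: "0 \<le> ln s" "0 \<le> ln n" using assms by auto
  \<comment> \<open>\<open>0 \<le> p < 1 - \<epsilon>\<close> forces \<open>\<epsilon> < 1\<close>,
    so a sample size of order \<open>1 / \<epsilon>\<^sup>2\<close> covers the order
    \<open>1 / \<epsilon>\<close> that the exponential bound needs.\<close>
  have "\<epsilon>\<^sup>2 \<le> \<epsilon>" using assms by (simp add: power2_eq_square mult_left_le)
  then have "(ln s + ln n) / \<epsilon> \<le> (ln s + ln n) / \<epsilon>\<^sup>2"
    using assms ln0 by (intro divide_left_mono) auto
  then have "2 * ((ln s + ln n) / \<epsilon>) \<le> real m" using m by linarith
  then have em: "2 * (ln s + ln n) \<le> \<epsilon> * real m"
    using assms by (simp add: field_simps)
  have "p \<le> exp (- \<epsilon>)" using exp_ge_add_one_self[of "- \<epsilon>"] assms by linarith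
  then have "p ^ m \<le> exp (- \<epsilon>) ^ m" using assms by (intro power_mono)
  also have "\<dots> = exp (- (\<epsilon> * real m))" by (simp add: exp_of_nat_mult[symmetric] mult.commute)
  \<comment> \<open>One \<open>ln s\<close> is given away; both copies of \<open>ln n\<close> are
    kept, one for the union over \<open>k\<close> and one for the final failure probability.\<close>
  also have "\<dots> \<le> exp (- (ln s + 2 * ln n))" using em ln0 by simp
  also have "\<dots> = 1 / (exp (ln s) * exp (ln n) ^ 2)"
    by (simp only: exp_minus exp_add exp_double inverse_eq_divide)
  also have "\<dots> = 1 / (s * n\<^sup>2)"
    using assms by simp
  finally show ?thesis .
qed

theorem theorem6:
  "\<exists>C::real. C > 0 \<and>
     (\<forall>(d::nat) (n::nat) (D :: point set) (\<S> :: point set set) (K :: nat set)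
        (\<epsilon>::real) (\<gamma>::nat) (m::nat).
        d \<ge> 2 \<longrightarrow> dataset d D \<longrightarrow> card D = n \<longrightarrow>
        \<S> \<noteq> {} \<longrightarrow> (\<forall>S\<in>\<S>. S \<noteq> {} \<and> S \<subseteq> D) \<longrightarrow>
        K \<subseteq> {1..n} \<longrightarrow> \<epsilon> > 0 \<longrightarrow> \<gamma> \<ge> 1 \<longrightarrow>
        int m = \<lceil>C * ((ln (real (card \<S>)) + ln (real n)) / \<epsilon>\<^sup>2)\<rceil> \<longrightarrow>
        measure (samples d m)
          {\<omega> \<in> space (samples d m).
             \<forall>S\<in>\<S>. \<forall>k\<in>K.
               max_rank d D (\<omega> ` {..<m} \<union> grid_vectors d \<gamma>) S \<le> k \<longrightarrow> area_ratio d D k S \<ge> 1 - \<epsilon>}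
          \<ge> 1 - 1 / real n)"
proof (intro exI[of _ 2] conjI allI impI)
  show "(0::real) < 2" by simp
next
  fix d n :: nat and D :: "point set" and \<S> :: "point set set" and K :: "nat set"
    and \<epsilon> :: real and \<gamma> m :: nat
  assume d: "d \<ge> 2" and D: "dataset d D" and n: "card D = n" and \<S>: "\<S> \<noteq> {}"
    "\<forall>S\<in>\<S>. S \<noteq> {} \<and> S \<subseteq> D" and K: "K \<subseteq> {1..n}" and \<epsilon>: "\<epsilon> > 0"
    and m: "int m = \<lceil>2 * ((ln (real (card \<S>)) + ln (real n)) / \<epsilon>\<^sup>2)\<rceil>"
  have finD: "finite D" using D by (simp add: dataset_def)
  \<comment> \<open>Since \<open>d \<ge> 2\<close> there is an attribute, and some tuple must attain
    1 in it.\<close>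
  have "D \<noteq> {}" using D d by (force simp: dataset_def)
  then have n1: "n \<ge> 1" using finD n by (simp add: Suc_le_eq card_gt_0_iff flip: n)
  have fin\<S>: "finite \<S>" by (rule finite_subset[of _ "Pow D"]) (use \<S>(2) finD in auto)
  have s1: "card \<S> \<ge> 1" using fin\<S> \<S>(1) by (simp add: Suc_le_eq card_gt_0_iff)
  have finK: "finite K" using K finite_subset by blast
  have cardK: "card K \<le> n" using card_mono[OF _ K] by simp
  have SS: "S \<noteq> {}" "S \<subseteq> D" "finite S" if "S \<in> \<S>" for S
    using \<S>(2) that finD finite_subset by blast+
  interpret prob_space "samples d m" by (rule prob_space_samples) (use d in simp)
  \<comment> \<open>This set does not depend on the samples; for every other pair the claimed
    implication holds for all outcomes.\<close>
  define bad where "bad = {(S, k). S \<in> \<S> \<and> k \<in> K \<and> area_ratio d D k S < 1 - \<epsilon>}"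
  define E where "E = (\<lambda>(S, k). {\<omega> \<in> space (samples d m).
      max_rank d D (\<omega> ` {..<m} \<union> grid_vectors d \<gamma>) S \<le> k})"
  have bad_sub: "bad \<subseteq> \<S> \<times> K" by (auto simp: bad_def)
  then have fin_bad: "finite bad" using finite_subset fin\<S> finK by blast
  have "card bad \<le> card (\<S> \<times> K)" using bad_sub fin\<S> finK by (intro card_mono) auto
  also have "\<dots> \<le> card \<S> * n" using cardK by (simp add: card_cartesian_product)
  finally have card_bad: "real (card bad) \<le> real (card \<S>) * real n"
    by (metis of_nat_le_iff of_nat_mult)

  let ?R = "\<lambda>S k. rank_region d D k S"
  have m_ge: "real m \<ge> 2 * ((ln (real (card \<S>)) + ln (real n)) / \<epsilon>\<^sup>2)"
    using m by linarith
  have R: "?R S k \<in> sets (uniform_sphere d)" if "S \<in> \<S>" for S k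
    using rank_region_sets[OF finD SS(3,1)[OF that]] by (simp add: sets_uniform_sphere)
  have PiR: "({..<m} \<rightarrow>\<^sub>E ?R S k) \<in> events" if "S \<in> \<S>" for S k
    unfolding samples_def using R[OF that] by (intro sets_PiM_I_finite) auto
  \<comment> \<open>The grid is deterministic, so its condition either holds for every outcome or
    empties the event. In both cases \<open>E (S, k)\<close> is measurable and contained in the
    box.\<close>
  have E_eq: "E (S, k) =
      (if \<forall>u\<in>grid_vectors d \<gamma>. rank_set d D u S \<le> k then {..<m} \<rightarrow>\<^sub>E ?R S k else {})" for S k
  proof -
    have "max_rank d D (\<omega> ` {..<m} \<union> grid_vectors d \<gamma>) S \<le> k \<longleftrightarrow>
        (\<forall>j<m. rank_set d D (\<omega> j) S \<le> k) \<and> (\<forall>u\<in>grid_vectors d \<gamma>. rank_set d D u S \<le> k)" for \<omega>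
      by (subst max_rank_le_iff) (auto simp: finite_grid_vectors grid_vectors_nonempty)
    then show ?thesis
      by (auto simp: E_def samples_def space_PiM space_uniform_sphere rank_region_def PiE_def Pi_iff)
  qed
  have E_ev: "E x \<in> events" if "x \<in> bad" for x
    using that PiR by (cases x) (auto simp: E_eq bad_def)
  have E_le: "prob (E x) \<le> 1 / (real (card \<S>) * (real n)\<^sup>2)" if "x \<in> bad" for x
  proof -
    obtain S k where x: "x = (S, k)" "S \<in> \<S>" "k \<in> K" "area_ratio d D k S < 1 - \<epsilon>"
      using \<open>x \<in> bad\<close> by (auto simp: bad_def)
    have ratio: "measure (uniform_sphere d) (?R S k) = area_ratio d D k S"
      using x K d n SS finD by (intro measure_rank_region) auto
    have "prob (E x) \<le> prob ({..<m} \<rightarrow>\<^sub>E ?R S k)"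
      unfolding x(1) E_eq by (intro finite_measure_mono PiR x) auto
    also have "\<dots> = measure (uniform_sphere d) (?R S k) ^ m"
      by (rule measure_samples_all_in) (use d R x in auto)
    also have "\<dots> \<le> 1 / (real (card \<S>) * (real n)\<^sup>2)"
      by (rule power_le_inverse_of_sample_size[OF measure_nonneg _ \<epsilon> _ _ m_ge]) (use ratio x s1 n1 in auto)
    finally show ?thesis .
  qed
  have "prob (\<Union>x\<in>bad. E x) \<le> (\<Sum>x\<in>bad. prob (E x))"
    using E_ev by (intro finite_measure_subadditive_finite fin_bad) auto
  also have "\<dots> \<le> real (card bad) * (1 / (real (card \<S>) * (real n)\<^sup>2))"
    using E_le by (intro sum_bounded_above) auto
  \<comment> \<open>The number of pairs cancels \<open>card \<S>\<close> and one factor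
    \<open>n\<close>, leaving \<open>1 / n\<close>.\<close>
  also have "\<dots> \<le> real (card \<S>) * real n * (1 / (real (card \<S>) * (real n)\<^sup>2))"
    by (intro mult_right_mono card_bad) auto
  also have "\<dots> = 1 / real n"
    using s1 n1 by (simp add: power2_eq_square)
  finally have union: "prob (\<Union>x\<in>bad. E x) \<le> 1 / real n" .
  \<comment> \<open>The implication fails exactly when \<open>E\<close> occurs for some bad pair, so
    the good set is the complement of a finite union of events and \<open>prob_compl\<close>
    applies.\<close>
  have "{\<omega> \<in> space (samples d m). \<forall>S\<in>\<S>. \<forall>k\<in>K.
      max_rank d D (\<omega> ` {..<m} \<union> grid_vectors d \<gamma>) S \<le> k \<longrightarrow> area_ratio d D k S \<ge> 1 - \<epsilon>} =
      space (samples d m) - (\<Union>x\<in>bad. E x)"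
    by (fastforce simp: bad_def E_def not_le)
  moreover have "(\<Union>x\<in>bad. E x) \<in> events" using E_ev fin_bad by auto
  ultimately show "measure (samples d m)
          {\<omega> \<in> space (samples d m).
             \<forall>S\<in>\<S>. \<forall>k\<in>K.
               max_rank d D (\<omega> ` {..<m} \<union> grid_vectors d \<gamma>) S \<le> k \<longrightarrow> area_ratio d D k S \<ge> 1 - \<epsilon>}
          \<ge> 1 - 1 / real n"
    using union by (simp add: prob_compl)
qed

end
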